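(* Let $\mathbb{K}\in\{\mathbb{R},\mathbb{C}\}$, let $n\ge m$, let $\mathcal{G}$ be a star-shaped DAG on the vertices $\{1,\dots,m\}$ and let $f\in\mathbb{K}^{n\times m}$ be a sample. If the MLE given $f$ exists in the DAG model on $\mathcal{G}$, then the MLE given any stabilisation of $f$ is the unique MLE given $f$ of minimal $2$-norm.
   Context: $\mathbb{K}^n,\mathbb{K}^m$ carry the standard (Hermitian) inner products. For a DAG $\mathcal{G}$ on $\{1,\dots,m\}$, $\mathrm{pa}(i)=\{j: j\to i\}$; a child vertex is a vertex $i$ with $\mathrm{pa}(i)\ne\emptyset$. A star-shaped DAG is a connected DAG with a unique child vertex. DAG model on $\mathcal{G}$: parameters are pairs $(\Lambda,\omega)$ with $\Lambda=(\lambda_{ij})\in\mathbb{K}^{m\times m}$ (the edge weights), $\lambda_{ij}=0$ unless $j\to i$, and $\omega\in\mathbb{R}_{>0}^m$ (the variances). A sample is a matrix $Y\in\mathbb{K}^{n\times m}$ with columns $Y^{(1)},\dots,Y^{(m)}$, viewed as a linear map $\mathbb{K}^m\to\mathbb{K}^n$. An MLE given $Y$ is a parameter pair $(\Lambda,\omega)$ minimising $\sum_{i=1}^m\big(\log\omega_i+\tfrac1{n\omega_i}\|Y^{(i)}-\sum_{j\in\mathrm{pa}(i)}\lambda_{ij}Y^{(j)}\|^2\big)$. All MLEs given $Y$ share the same $\omega$, so an MLE given $Y$ has minimal $2$-norm exactly when its edge-weight part $\Lambda$ has minimal Euclidean norm among the edge-weight parts of MLEs given $Y$. Given $f:\mathbb{K}^m\to\mathbb{K}^n$,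 an $f$-perturbation is a linear map $f':\mathbb{K}^m\to\mathbb{K}^n$ with $\operatorname{im}f'\subseteq(\operatorname{im}f)^\perp$ and $(\ker f')^\perp=\ker f$. A stabilisation of $f$ is a sum $\widetilde f=f+f'$ with $f'$ an $f$-perturbation; the MLE given a stabilisation is unique.
   Formalization: The MLE given a stabilisation is claimed to agree with the unique minimal 2-norm MLE given f only in its edge weights Λ; the variances ω may differ, since equality of the full pairs fails whenever the perturbation is non-zero. *)

theory Defs
  imports "HOL-Analysis.Analysis" "Jordan_Normal_Form.Conjugate"
begin

text \<open>
  The vertex set is the finite index type \<open>'m\<close>, and \<open>(j, i) \<in> E\<close> means \<open>j \<rightarrow> i\<close>.
  Matrices of size \<open>n \<times> m\<close> over \<open>'k\<close> have type \<open>'k ^ 'm ^ 'n\<close>. The definitions are used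
  with \<open>'k = real\<close> and \<open>'k = complex\<close>, where \<open>conjugate\<close> is the identity and complex
  conjugation respectively.
\<close>

definition pa :: "('m \<times> 'm) set \<Rightarrow> 'm \<Rightarrow> 'm set" where
  "pa E i = {j. (j, i) \<in> E}"

definition child_vertex :: "('m \<times> 'm) set \<Rightarrow> 'm \<Rightarrow> bool" where
  "child_vertex E i \<longleftrightarrow> pa E i \<noteq> {}"

text \<open>Connectedness of a DAG refers to its underlying undirected graph.\<close>

definition star_shaped_DAG :: "('m \<times> 'm) set \<Rightarrow> bool" where
  "star_shaped_DAG E \<longleftrightarrow>
     acyclic E \<and> (\<forall>i j. (i, j) \<in> (E \<union> E\<inverse>)\<^sup>*) \<and> (\<exists>!i. child_vertex E i)"

text \<open>The entry \<open>\<lambda>\<^sub>i\<^sub>j\<close> of the edge-weight matrix belongs to the edge \<open>j \<rightarrow> i\<close>.\<close>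

definition DAG_params ::
    "('m::finite \<times> 'm) set \<Rightarrow> ((('k::zero) ^ 'm ^ 'm) \<times> (real ^ 'm)) set" where
  "DAG_params E =
     {(\<Lambda>, \<omega>). (\<forall>i j. (j, i) \<notin> E \<longrightarrow> \<Lambda> $ i $ j = 0) \<and> (\<forall>i. 0 < \<omega> $ i)}"

definition DAG_loss ::
    "('m::finite \<times> 'm) set \<Rightarrow> ('k::real_normed_field) ^ 'm ^ 'n \<Rightarrow>
     ('k ^ 'm ^ 'm) \<times> (real ^ 'm) \<Rightarrow> real" where
  "DAG_loss E Y = (\<lambda>(\<Lambda>, \<omega>).
     \<Sum>i\<in>UNIV. ln (\<omega> $ i) + 1 / (real CARD('n) * \<omega> $ i) *
       (norm (column i Y - (\<Sum>j\<in>pa E i. \<Lambda> $ i $ j *s column j Y)))\<^sup>2)"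

definition is_MLE ::
    "('m::finite \<times> 'm) set \<Rightarrow> ('k::real_normed_field) ^ 'm ^ 'n \<Rightarrow>
     ('k ^ 'm ^ 'm) \<times> (real ^ 'm) \<Rightarrow> bool" where
  "is_MLE E Y \<theta> \<longleftrightarrow> is_arg_min (DAG_loss E Y) (\<lambda>\<theta>. \<theta> \<in> DAG_params E) \<theta>"

text \<open>
  The norm on pairs of matrices and vectors is the Euclidean norm of all entries, so this
  is the \<open>2\<close>-norm of the whole parameter pair.
\<close>

definition is_min_norm_MLE ::
    "('m::finite \<times> 'm) set \<Rightarrow> ('k::real_normed_field) ^ 'm ^ 'n \<Rightarrow>
     ('k ^ 'm ^ 'm) \<times> (real ^ 'm) \<Rightarrow> bool" where
  "is_min_norm_MLE E Y \<theta> \<longleftrightarrow> is_arg_min norm (is_MLE E Y) \<theta>"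

definition herm_inner :: "('k::conjugatable_field) ^ 'n \<Rightarrow> 'k ^ 'n \<Rightarrow> 'k" where
  "herm_inner x y = (\<Sum>i\<in>UNIV. x $ i * conjugate (y $ i))"

definition herm_perp :: "(('k::conjugatable_field) ^ 'n) set \<Rightarrow> ('k ^ 'n) set" where
  "herm_perp S = {x. \<forall>y\<in>S. herm_inner x y = 0}"

definition mat_ker :: "('k::semiring_1) ^ 'm ^ 'n \<Rightarrow> ('k ^ 'm) set" where
  "mat_ker f = {x. f *v x = 0}"

definition is_perturbation ::
    "('k::conjugatable_field) ^ 'm ^ 'n \<Rightarrow> 'k ^ 'm ^ 'n \<Rightarrow> bool" where
  "is_perturbation f f' \<longleftrightarrow>
     range ((*v) f') \<subseteq> herm_perp (range ((*v) f)) \<and> herm_perp (mat_ker f') = mat_ker f"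

definition is_stabilisation ::
    "('k::conjugatable_field) ^ 'm ^ 'n \<Rightarrow> 'k ^ 'm ^ 'n \<Rightarrow> bool" where
  "is_stabilisation f g \<longleftrightarrow> (\<exists>f'. is_perturbation f f' \<and> g = f + f')"

text \<open>
  The variance of a non-child vertex is the mean squared norm of its sample column, and a
  stabilisation of a non-injective \<open>f\<close> can change it. An MLE given a stabilisation is
  therefore compared with an MLE given \<open>f\<close> through the edge-weight matrix \<open>\<Lambda>\<close>.
\<close>

end

theory Submission
  imports Defs
begin

text \<open>
  In a star with centre \<open>c\<close>, maximum likelihood estimation amounts to minimising \<open>\<parallel>f v\<parallel>\<close> over
  the vectors \<open>v\<close> with \<open>v\<^sub>c = 1\<close>, whose other entries are the negated edge weights. An MLE
  exists only if the minimum is positive, and then every vector of \<open>ker f\<close> vanishes at \<open>c\<close>.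
  Hence the minimisers form a translate of \<open>ker f\<close>, and the one of least norm is the one in
  \<open>(ker f)\<^sup>\<bottom>\<close>. A perturbation \<open>f'\<close> vanishes there, while
  \<open>\<parallel>(f + f') v\<parallel>\<^sup>2 = \<parallel>f v\<parallel>\<^sup>2 + \<parallel>f' v\<parallel>\<^sup>2 \<ge> \<parallel>f v\<parallel>\<^sup>2\<close>, so that vector also minimises
  \<open>\<parallel>(f + f') v\<parallel>\<close>; since \<open>f + f'\<close> is injective, it is the only minimiser.
\<close>

section \<open>Scalars and the Hermitian inner product\<close>

text \<open>Treats the real and the complex case at once. The axiom ties conjugation to the
  Euclidean structure, from which orthogonal projections come.\<close>

class hermitian_field = conjugatable_field + real_normed_field + euclidean_space +
  assumes mult_conjugate_scaleR: "x * conjugate x = (norm x)\<^sup>2 *\<^sub>R 1"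

instance real :: hermitian_field
  by standard (simp add: power2_eq_square)

instance complex :: hermitian_field
  by standard (metis complex_norm_square conjugate_complex_def of_real_def)

lemma mult_conjugate_norm: "x * conjugate x = of_real ((norm x)\<^sup>2)"
  for x :: "'k::hermitian_field"
  by (simp add: of_real_def mult_conjugate_scaleR)

text \<open>Expanding the class axiom at \<open>x + y\<close> shows that the real inner product is
  the real part of the Hermitian one.\<close>

lemma hermitian_polarisation:
  fixes x y :: "'k::hermitian_field"
  shows "x * conjugate y + y * conjugate x = of_real (2 * inner x y)"
proof -
  have "(x + y) * conjugate (x + y) = of_real ((norm (x + y))\<^sup>2)"
    by (rule mult_conjugate_norm)
  also have "(norm (x + y))\<^sup>2 = (norm x)\<^sup>2 + (norm y)\<^sup>2 + 2 * inner x y"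
    by (simp add: power2_norm_eq_inner inner_simps inner_commute)
  finally show ?thesis
    by (simp add: conjugate_dist_add distrib_left distrib_right mult_conjugate_norm add.commute)
qed

lemma herm_inner_polarisation:
  fixes x y :: "'k::hermitian_field ^ 'n"
  shows "herm_inner x y + herm_inner y x = of_real (2 * inner x y)"
  by (simp add: herm_inner_def inner_vec_def hermitian_polarisation sum_distrib_left
      flip: sum.distrib)

lemma herm_inner_commute: "herm_inner y x = conjugate (herm_inner x y)"
  by (simp add: herm_inner_def sum_conjugate conjugate_dist_mul mult.commute)

lemma herm_inner_scale_left: "herm_inner (a *s x) y = a * herm_inner x y"
  by (simp add: herm_inner_def sum_distrib_left mult.assoc)

lemma herm_inner_eq_0_imp_orthogonal:
  fixes x y :: "'k::hermitian_field ^ 'n"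
  assumes "herm_inner x y = 0"
  shows "orthogonal x y"
proof -
  have "of_real (2 * inner x y) = (0 :: 'k)"
    using herm_inner_polarisation[of x y] herm_inner_commute[of y x] assms by simp
  then show ?thesis
    unfolding of_real_eq_0_iff by (simp add: orthogonal_def)
qed

text \<open>Testing \<open>z\<close> against \<open>\<langle>z, y\<rangle> y\<close> turns real into Hermitian orthogonality.\<close>

lemma herm_perpI:
  fixes z :: "'k::hermitian_field ^ 'n"
  assumes scale: "\<And>a y. y \<in> S \<Longrightarrow> a *s y \<in> S"
    and orth: "\<And>y. y \<in> S \<Longrightarrow> orthogonal z y"
  shows "z \<in> herm_perp S"
  unfolding herm_perp_def
proof (intro CollectI ballI)
  fix y assume "y \<in> S"
  define h where "h = herm_inner z y"
  have "inner z (h *s y) = 0"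
    using orth[OF scale[OF \<open>y \<in> S\<close>]] by (simp add: orthogonal_def)
  moreover have "herm_inner (h *s y) z = of_real ((norm h)\<^sup>2)"
    using herm_inner_commute[of y z]
    by (simp add: herm_inner_scale_left h_def mult_conjugate_norm)
  moreover have "herm_inner z (h *s y) = conjugate (herm_inner (h *s y) z)"
    by (rule herm_inner_commute)
  \<comment> \<open>Being self-conjugate, this number is the Hermitian product of \<open>z\<close>
    and \<open>h *s y\<close> in either order, so polarisation yields twice it.\<close>
  moreover have "conjugate (h * conjugate h) = h * conjugate h"
    by (simp add: conjugate_dist_mul mult.commute)
  ultimately have "of_real (2 * (norm h)\<^sup>2) = (0 :: 'k)"
    using herm_inner_polarisation[of z "h *s y"] by (simp add: mult_conjugate_norm)
  then have "h = 0"
    unfolding of_real_eq_0_iff by simp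
  then show "herm_inner z y = 0"
    by (simp add: h_def)
qed

section \<open>Kernels and their orthogonal complements\<close>

lemma matrix_vector_mult_axis: "A *v axis i 1 = column i A"
  for A :: "'k::semiring_1 ^ 'm ^ 'n"
  by (simp add: vec_eq_iff matrix_vector_mult_def column_def axis_def if_distrib cong: if_cong)

lemma mat_ker_scale: "y \<in> mat_ker A \<Longrightarrow> a *s y \<in> mat_ker A"
  for A :: "'k::field ^ 'm ^ 'n"
  by (simp add: mat_ker_def vector_scalar_commute)

text \<open>Meant over the reals, as the Euclidean orthogonal decomposition requires.\<close>

lemma subspace_mat_ker: "subspace (mat_ker A)"
  for A :: "'k::real_normed_field ^ 'm ^ 'n"
proof (rule subspaceI)
  fix c x assume "x \<in> mat_ker A"
  moreover have "c *\<^sub>R x = of_real c *s x"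
    by (simp add: vec_eq_iff) (simp add: scaleR_conv_of_real)
  ultimately show "c *\<^sub>R x \<in> mat_ker A"
    by (simp add: mat_ker_scale)
qed (simp_all add: mat_ker_def matrix_vector_right_distrib)

text \<open>The kernel is closed under all scalars, so its real orthogonal complement is also the
  Hermitian one.\<close>

lemma mat_ker_decomposition:
  fixes A :: "'k::hermitian_field ^ 'm ^ 'n"
  obtains y z where "x = y + z" "y \<in> mat_ker A" "z \<in> herm_perp (mat_ker A)"
proof -
  have span: "span (mat_ker A) = mat_ker A"
    by (simp add: subspace_mat_ker)
  obtain y z where yz: "y \<in> mat_ker A" "\<And>w. w \<in> mat_ker A \<Longrightarrow> orthogonal z w" "x = y + z"
    using orthogonal_subspace_decomp_exists[of "mat_ker A" x] unfolding span by metis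
  moreover have "z \<in> herm_perp (mat_ker A)"
    by (rule herm_perpI[OF mat_ker_scale yz(2)])
  ultimately show thesis
    using that by blast
qed

lemma orthogonal_herm_perp:
  fixes x y :: "'k::hermitian_field ^ 'n"
  assumes "x \<in> herm_perp S" "y \<in> S"
  shows "orthogonal x y"
  using assms by (simp add: herm_perp_def herm_inner_eq_0_imp_orthogonal)

text \<open>In \<open>x = y + z\<close> the component \<open>z\<close> is orthogonal to both
  \<open>x\<close> and \<open>y\<close>, hence to itself.\<close>

lemma herm_perp_herm_perp_mat_ker:
  fixes A :: "'k::hermitian_field ^ 'm ^ 'n"
  shows "herm_perp (herm_perp (mat_ker A)) \<subseteq> mat_ker A"
proof
  fix x assume x: "x \<in> herm_perp (herm_perp (mat_ker A))"
  obtain y z where yz: "x = y + z" "y \<in> mat_ker A" "z \<in> herm_perp (mat_ker A)"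
    by (rule mat_ker_decomposition)
  have "inner x z = 0" "inner z y = 0"
    using orthogonal_herm_perp x yz by (auto simp: orthogonal_def)
  then have "inner z z = 0"
    unfolding yz(1) inner_add_left by (simp add: inner_commute)
  then show "x \<in> mat_ker A"
    using yz by simp
qed

section \<open>Perturbations and stabilisations\<close>

lemma perturbation_orthogonal:
  fixes f :: "'k::hermitian_field ^ 'm ^ 'n"
  assumes "is_perturbation f f'"
  shows "(norm ((f + f') *v x))\<^sup>2 = (norm (f *v x))\<^sup>2 + (norm (f' *v x))\<^sup>2"
proof -
  have "f' *v x \<in> herm_perp (range ((*v) f))"
    using assms unfolding is_perturbation_def by blast
  then have "orthogonal (f' *v x) (f *v x)"
    by (rule orthogonal_herm_perp) simp
  then have "orthogonal (f *v x) (f' *v x)"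
    by (simp add: orthogonal_commute)
  then show ?thesis
    by (simp add: matrix_vector_mult_add_rdistrib norm_add_Pythagorean)
qed

lemma perturbation_vanishes_on_perp_ker:
  fixes f :: "'k::hermitian_field ^ 'm ^ 'n"
  assumes "is_perturbation f f'" "x \<in> herm_perp (mat_ker f)"
  shows "f' *v x = 0"
  using assms herm_perp_herm_perp_mat_ker[of f'] by (auto simp: is_perturbation_def mat_ker_def)

text \<open>By Pythagoras, a vector killed by the sum is killed by both summands. It then lies in
  \<open>mat_ker f'\<close> and in its complement \<open>mat_ker f\<close>.\<close>

lemma stabilisation_injective:
  fixes f :: "'k::hermitian_field ^ 'm ^ 'n"
  assumes pert: "is_perturbation f f'" and "(f + f') *v x = 0"
  shows "x = 0"
proof -
  have "(norm (f *v x))\<^sup>2 + (norm (f' *v x))\<^sup>2 = 0"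
    using perturbation_orthogonal[OF pert, of x] assms(2) by simp
  then have "x \<in> mat_ker f" "x \<in> mat_ker f'"
    by (simp_all add: mat_ker_def sum_power2_eq_zero_iff)
  moreover have "mat_ker f = herm_perp (mat_ker f')"
    using pert by (simp add: is_perturbation_def)
  ultimately have "orthogonal x x"
    using orthogonal_herm_perp by blast
  then show "x = 0"
    by (simp add: orthogonal_self)
qed

section \<open>Optimality conditions vertex by vertex\<close>

text \<open>The loss at one vertex, with variance \<open>w\<close> and squared residual
  \<open>a r\<close>. For \<open>b = a r / N > 0\<close>, the inequality ln t \<le> t - 1, strict
  unless t = 1, taken at \<open>b / w\<close>, makes \<open>w = b\<close> the only optimum. For
  \<open>a r = 0\<close>, halving \<open>w\<close> always lowers the loss.\<close>

lemma ln_add_divide_arg_min_iff: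
  fixes a :: "'r \<Rightarrow> real"
  assumes "0 < w" and nonneg: "\<And>r. 0 \<le> a r" and N: "0 < N" and "R r"
  shows "(\<forall>s v. R s \<and> 0 < v \<longrightarrow> ln w + 1 / (N * w) * a r \<le> ln v + 1 / (N * v) * a s) \<longleftrightarrow>
         0 < a r \<and> w = a r / N \<and> (\<forall>s. R s \<longrightarrow> a r \<le> a s)" (is "?L \<longleftrightarrow> ?R")
proof
  assume L: ?L
  have le: "a r \<le> a s" if "R s" for s
    using L[rule_format, of s w] \<open>0 < w\<close> N that by (simp add: divide_le_cancel)
  have pos: "0 < a r"
  proof (rule ccontr)
    assume "\<not> 0 < a r"
    then have "a r = 0"
      using nonneg[of r] by simp
    then have "ln w \<le> ln (w / 2)"
      using L[rule_format, of r "w / 2"] \<open>R r\<close> \<open>0 < w\<close> by simp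
    then show False
      using \<open>0 < w\<close> by simp
  qed
  define b where "b = a r / N"
  have b: "0 < b" "a r = N * b"
    using pos N by (simp_all add: b_def)
  \<comment> \<open>Competitor: the same \<open>r\<close> with variance \<open>b\<close>. It forces
    equality in ln t \<le> t - 1.\<close>
  have "ln w + b / w \<le> ln b + 1"
    using L[rule_format, of r b] \<open>R r\<close> N b by simp
  then have "b / w - 1 \<le> ln (b / w)"
    using b \<open>0 < w\<close> by (simp add: ln_div)
  then have "b / w = 1"
    using b \<open>0 < w\<close> by (intro ln_eq_minus_one antisym ln_le_minus_one) auto
  then have "w = b"
    using \<open>0 < w\<close> by simp
  then show ?R
    using le pos by (auto simp: b_def)
next
  assume R: ?R
  define b where "b = a r / N"
  have b: "0 < b" "a r = N * b" "w = b"
    using R N by (simp_all add: b_def)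
  show ?L
  proof (intro allI impI)
    fix s and v :: real assume sv: "R s \<and> 0 < v"
    have "ln (b / v) \<le> b / v - 1"
      using b sv by (intro ln_le_minus_one) simp
    then have "ln b + 1 \<le> ln v + b / v"
      using b sv by (simp add: ln_div)
    moreover have "ln w + 1 / (N * w) * a r = ln b + 1" "b / v = 1 / (N * v) * a r"
      using N b sv by simp_all
    moreover have "1 / (N * v) * a r \<le> 1 / (N * v) * a s"
      using R N sv by (intro mult_left_mono) auto
    ultimately show "ln w + 1 / (N * w) * a r \<le> ln v + 1 / (N * v) * a s"
      by simp
  qed
qed

definition residual :: "('m::finite \<times> 'm) set \<Rightarrow> ('k::real_normed_field) ^ 'm ^ 'n \<Rightarrow> 'm \<Rightarrow>
    'k ^ 'm \<Rightarrow> 'k ^ 'n" where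
  "residual E Y i r = column i Y - (\<Sum>j\<in>pa E i. r $ j *s column j Y)"

definition row_params :: "('m \<times> 'm) set \<Rightarrow> 'm \<Rightarrow> ('k::zero) ^ 'm \<Rightarrow> bool" where
  "row_params E i r \<longleftrightarrow> (\<forall>j. (j, i) \<notin> E \<longrightarrow> r $ j = 0)"

text \<open>Each summand of the loss, and each constraint, involves only one row of
  \<open>\<Lambda>\<close> and one entry of \<open>\<omega>\<close>, so the problem splits into
  independent problems at the vertices.\<close>

lemma is_MLE_iff:
  fixes E :: "('m::finite \<times> 'm) set" and Y :: "'k::real_normed_field ^ 'm ^ 'n"
  shows "is_MLE E Y (\<Lambda>, \<omega>) \<longleftrightarrow>
    (\<forall>i. row_params E i (\<Lambda> $ i) \<and> residual E Y i (\<Lambda> $ i) \<noteq> 0 \<and>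
         \<omega> $ i = (norm (residual E Y i (\<Lambda> $ i)))\<^sup>2 / real CARD('n) \<and>
         (\<forall>r. row_params E i r \<longrightarrow>
            norm (residual E Y i (\<Lambda> $ i)) \<le> norm (residual E Y i r)))" (is "_ \<longleftrightarrow> ?R")
proof -
  define L where "L i r w = ln w + 1 / (real CARD('n) * w) * (norm (residual E Y i r))\<^sup>2"
    for i r and w :: real
  have loss: "DAG_loss E Y (M, w) = (\<Sum>i\<in>UNIV. L i (M $ i) (w $ i))" for M w
    by (simp add: DAG_loss_def L_def residual_def)
  have params: "(M, w) \<in> DAG_params E \<longleftrightarrow> (\<forall>i. row_params E i (M $ i) \<and> 0 < w $ i)"
    for M :: "'k ^ 'm ^ 'm" and w
    by (auto simp: DAG_params_def row_params_def)
  have step: "(\<forall>s v. row_params E i s \<and> 0 < v \<longrightarrow> L i r w \<le> L i s v) \<longleftrightarrow>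
      residual E Y i r \<noteq> 0 \<and> w = (norm (residual E Y i r))\<^sup>2 / real CARD('n) \<and>
      (\<forall>s. row_params E i s \<longrightarrow> norm (residual E Y i r) \<le> norm (residual E Y i s))"
    if "row_params E i r" "0 < w" for i r w
    using ln_add_divide_arg_min_iff[of w "\<lambda>r. (norm (residual E Y i r))\<^sup>2" "real CARD('n)"
        "row_params E i" r] that
    unfolding L_def by (simp add: power_mono_iff)
  have "is_MLE E Y (\<Lambda>, \<omega>) \<longleftrightarrow> (\<forall>i. row_params E i (\<Lambda> $ i) \<and> 0 < \<omega> $ i) \<and>
      (\<forall>M w. (\<forall>i. row_params E i (M $ i) \<and> 0 < w $ i) \<longrightarrow>
         (\<Sum>i\<in>UNIV. L i (\<Lambda> $ i) (\<omega> $ i)) \<le> (\<Sum>i\<in>UNIV. L i (M $ i) (w $ i)))"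
    by (auto simp: is_MLE_def is_arg_min_linorder loss params)
  also have "\<dots> \<longleftrightarrow> (\<forall>i. row_params E i (\<Lambda> $ i) \<and> 0 < \<omega> $ i \<and>
      (\<forall>s v. row_params E i s \<and> 0 < v \<longrightarrow> L i (\<Lambda> $ i) (\<omega> $ i) \<le> L i s v))" (is "?P \<longleftrightarrow> ?Q")
  proof
    assume ?Q
    then show ?P
      by (auto intro!: sum_mono)
  next
    assume P: ?P
    have "L i (\<Lambda> $ i) (\<omega> $ i) \<le> L i s v" if "row_params E i s" "0 < v" for i s v
    proof -
      \<comment> \<open>Changing the parameters at \<open>i\<close> alone leaves all other summands
        equal, so they cancel.\<close>
      define M where "M = (\<chi> j. if j = i then s else \<Lambda> $ j)"
      define w where "w = (\<chi> j. if j = i then v else \<omega> $ j)"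
      have "(\<Sum>j\<in>UNIV. L j (\<Lambda> $ j) (\<omega> $ j)) \<le> (\<Sum>j\<in>UNIV. L j (M $ j) (w $ j))"
        by (rule P[THEN conjunct2, rule_format]) (use P that in \<open>simp add: M_def w_def\<close>)
      also have "\<dots> = L i s v + (\<Sum>j\<in>UNIV - {i}. L j (\<Lambda> $ j) (\<omega> $ j))"
        by (subst sum.remove[of _ i]) (auto simp: M_def w_def intro!: sum.cong)
      finally show ?thesis
        by (subst (asm) sum.remove[of _ i]) auto
    qed
    with P show ?Q
      by blast
  qed
  also have "\<dots> \<longleftrightarrow> ?R"
  proof (rule iff_allI)
    fix i
    have "0 < \<omega> $ i"
      if "residual E Y i (\<Lambda> $ i) \<noteq> 0"
        "\<omega> $ i = (norm (residual E Y i (\<Lambda> $ i)))\<^sup>2 / real CARD('n)"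
      using that by simp
    then show "row_params E i (\<Lambda> $ i) \<and> 0 < \<omega> $ i \<and>
        (\<forall>s v. row_params E i s \<and> 0 < v \<longrightarrow> L i (\<Lambda> $ i) (\<omega> $ i) \<le> L i s v) \<longleftrightarrow>
      row_params E i (\<Lambda> $ i) \<and> residual E Y i (\<Lambda> $ i) \<noteq> 0 \<and>
        \<omega> $ i = (norm (residual E Y i (\<Lambda> $ i)))\<^sup>2 / real CARD('n) \<and>
        (\<forall>r. row_params E i r \<longrightarrow>
          norm (residual E Y i (\<Lambda> $ i)) \<le> norm (residual E Y i r))"
      using step[of i "\<Lambda> $ i" "\<omega> $ i"] by argo
  qed
  finally show ?thesis .
qed

section \<open>Reduction to the centre of the star\<close>

text \<open>Every edge ends in the only child vertex \<open>c\<close>. By connectedness any other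
  vertex meets an edge, which must therefore run from it to \<open>c\<close>.\<close>

lemma star_shaped_DAG_pa:
  assumes "star_shaped_DAG E"
  obtains c where "\<And>i. pa E i = (if i = c then - {c} else {})"
proof -
  obtain c where c: "child_vertex E c" and uniq: "\<And>i. child_vertex E i \<Longrightarrow> i = c"
    using assms unfolding star_shaped_DAG_def by blast
  have heads: "y = c" if "(x, y) \<in> E" for x y
    using uniq[of y] that by (auto simp: child_vertex_def pa_def)
  have "(c, c) \<notin> E"
    using assms unfolding star_shaped_DAG_def acyclic_def by blast
  moreover have "(i, c) \<in> E" if "i \<noteq> c" for i
  proof -
    have "(i, c) \<in> (E \<union> E\<inverse>)\<^sup>*"
      using assms by (simp add: star_shaped_DAG_def)
    then obtain k where "(i, k) \<in> E \<union> E\<inverse>"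
      using \<open>i \<noteq> c\<close> by (auto elim: converse_rtranclE)
    then show ?thesis
      using heads that by blast
  qed
  ultimately have "pa E i = (if i = c then - {c} else {})" for i
    using heads by (auto simp: pa_def)
  then show thesis
    by (rule that)
qed

text \<open>The coefficient vector of the residual at \<open>c\<close> has entry \<open>1\<close> at \<open>c\<close> and \<open>-\<lambda>\<^sub>c\<^sub>j\<close> elsewhere.\<close>

definition residual_minimiser :: "'k::real_normed_field ^ 'm ^ 'n \<Rightarrow> 'm \<Rightarrow> 'k ^ 'm \<Rightarrow> bool" where
  "residual_minimiser Y c v \<longleftrightarrow>
     v $ c = 1 \<and> Y *v v \<noteq> 0 \<and> (\<forall>u. u $ c = 1 \<longrightarrow> norm (Y *v v) \<le> norm (Y *v u))"

text \<open>Inverts the passage from row \<open>c\<close> of the weights to the coefficient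
  vector.\<close>

definition star_weights :: "'m \<Rightarrow> 'k::real_normed_field ^ 'm \<Rightarrow> 'k ^ 'm ^ 'm" where
  "star_weights c v = (\<chi> i. if i = c then axis c 1 - v else 0)"

definition star_variances :: "'k::real_normed_field ^ 'm ^ 'n \<Rightarrow> 'm \<Rightarrow> 'k ^ 'm \<Rightarrow> real ^ 'm" where
  "star_variances Y c v =
     (\<chi> i. (norm (if i = c then Y *v v else column i Y))\<^sup>2 / real CARD('n))"

text \<open>Rows other than \<open>c\<close> must vanish, so their residuals are the columns
  themselves. At \<open>c\<close>, substituting \<open>axis c 1 - r\<close> for the row
  \<open>r\<close> leaves the minimisation of \<open>norm (Y *v u)\<close> over
  \<open>u $ c = 1\<close>.\<close>

lemma is_MLE_star_iff:
  fixes Y :: "'k::real_normed_field ^ 'm ^ 'n"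
  assumes pa: "\<And>i. pa E i = (if i = c then - {c} else {})"
  shows "is_MLE E Y \<theta> \<longleftrightarrow>
    (\<forall>i. i \<noteq> c \<longrightarrow> column i Y \<noteq> 0) \<and>
    (\<exists>v. residual_minimiser Y c v \<and> \<theta> = (star_weights c v, star_variances Y c v))"
proof -
  obtain \<Lambda> \<omega> where \<theta>: "\<theta> = (\<Lambda>, \<omega>)"
    by fastforce
  have edge: "(j, i) \<in> E \<longleftrightarrow> i = c \<and> j \<noteq> c" for i j
    using pa[of i] by (auto simp: pa_def split: if_splits)
  have rowc: "row_params E c r \<longleftrightarrow> r $ c = 0" for r :: "'k ^ 'm"
    by (auto simp: row_params_def edge)
  have row: "row_params E i r \<longleftrightarrow> r = 0" if "i \<noteq> c" for i and r :: "'k ^ 'm"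
    using that by (auto simp: row_params_def edge vec_eq_iff)
  have res: "residual E Y i r = column i Y" if "i \<noteq> c" for i r
    using that by (simp add: residual_def pa)
  have resc: "residual E Y c r = Y *v (axis c 1 - r)" if "r $ c = 0" for r
  proof -
    have "(\<Sum>j\<in>UNIV. r $ j *s column j Y) = (\<Sum>j\<in>- {c}. r $ j *s column j Y)"
      using that by (intro sum.mono_neutral_right) auto
    then show ?thesis
      using matrix_mult_sum[of Y r]
      by (simp add: residual_def pa matrix_vector_mult_diff_distrib matrix_vector_mult_axis)
  qed
  have shift: "(\<forall>r. r $ c = 0 \<longrightarrow> a \<le> norm (Y *v (axis c 1 - r))) \<longleftrightarrow>
      (\<forall>u. u $ c = 1 \<longrightarrow> a \<le> norm (Y *v u))" (is "?A \<longleftrightarrow> ?B") for a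
  proof
    assume A: ?A
    show ?B
    proof (intro allI impI)
      fix u :: "'k ^ 'm" assume "u $ c = 1"
      then show "a \<le> norm (Y *v u)"
        using A[rule_format, of "axis c 1 - u"] by simp
    qed
  qed simp
  define v where "v = axis c 1 - \<Lambda> $ c"
  have weights: "\<Lambda> = star_weights c u \<longleftrightarrow> (\<forall>i. i \<noteq> c \<longrightarrow> \<Lambda> $ i = 0) \<and> u = v" for u
    by (auto simp: star_weights_def v_def vec_eq_iff[of \<Lambda>])
  have "is_MLE E Y \<theta> \<longleftrightarrow>
    (\<forall>i. i \<noteq> c \<longrightarrow> \<Lambda> $ i = 0 \<and> column i Y \<noteq> 0 \<and> \<omega> $ i = (norm (column i Y))\<^sup>2 / real CARD('n)) \<and>
    residual_minimiser Y c v \<and> \<omega> $ c = (norm (Y *v v))\<^sup>2 / real CARD('n)"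
  proof -
    define R where "R i \<longleftrightarrow> row_params E i (\<Lambda> $ i) \<and> residual E Y i (\<Lambda> $ i) \<noteq> 0 \<and>
        \<omega> $ i = (norm (residual E Y i (\<Lambda> $ i)))\<^sup>2 / real CARD('n) \<and>
        (\<forall>r. row_params E i r \<longrightarrow> norm (residual E Y i (\<Lambda> $ i)) \<le> norm (residual E Y i r))" for i
    have "is_MLE E Y \<theta> \<longleftrightarrow> (\<forall>i. R i)"
      by (simp add: \<theta> is_MLE_iff R_def)
    also have "\<dots> \<longleftrightarrow> (\<forall>i. i \<noteq> c \<longrightarrow> R i) \<and> R c"
      by metis
    also have "(\<forall>i. i \<noteq> c \<longrightarrow> R i) \<longleftrightarrow> (\<forall>i. i \<noteq> c \<longrightarrow>
        \<Lambda> $ i = 0 \<and> column i Y \<noteq> 0 \<and> \<omega> $ i = (norm (column i Y))\<^sup>2 / real CARD('n))"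
      by (auto simp: R_def row res)
    also have "R c \<longleftrightarrow>
        residual_minimiser Y c v \<and> \<omega> $ c = (norm (Y *v v))\<^sup>2 / real CARD('n)"
    \<comment> \<open>If this entry is nonzero, both sides fail: the row is inadmissible and
      \<open>v $ c\<close> differs from \<open>1\<close>.\<close>
    proof (cases "\<Lambda> $ c $ c = 0")
      case True
      then have "R c \<longleftrightarrow> Y *v v \<noteq> 0 \<and> \<omega> $ c = (norm (Y *v v))\<^sup>2 / real CARD('n) \<and>
          (\<forall>r. r $ c = 0 \<longrightarrow> norm (Y *v v) \<le> norm (Y *v (axis c 1 - r)))"
        by (simp add: R_def rowc resc v_def)
      with True show ?thesis
        unfolding shift by (auto simp: residual_minimiser_def v_def)
    next
      case False
      then show ?thesis
        by (simp add: R_def rowc residual_minimiser_def v_def)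
    qed
    finally show ?thesis .
  qed
  also have "\<dots> \<longleftrightarrow> (\<forall>i. i \<noteq> c \<longrightarrow> column i Y \<noteq> 0) \<and>
      (\<exists>u. residual_minimiser Y c u \<and> \<theta> = (star_weights c u, star_variances Y c u))"
    by (auto simp: \<theta> weights star_variances_def vec_eq_iff[of \<omega>])
  finally show ?thesis .
qed

section \<open>Geometry of the residual minimisers\<close>

text \<open>Otherwise rescaling \<open>x\<close> to have entry \<open>1\<close> at \<open>c\<close>
  would give residual zero, below the positive minimum.\<close>

lemma residual_minimiser_kernel:
  assumes "residual_minimiser Y c v" "Y *v x = 0"
  shows "x $ c = 0"
proof (rule ccontr)
  assume "x $ c \<noteq> 0"
  then have "norm (Y *v v) \<le> norm (Y *v (inverse (x $ c) *s x))"
    using assms(1) by (simp add: residual_minimiser_def)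
  then show False
    using assms by (simp add: vector_scalar_commute residual_minimiser_def)
qed

text \<open>The midpoint of two minimisers is admissible, so by the parallelogram law their images
  cannot differ.\<close>

lemma residual_minimiser_image_unique:
  fixes Y :: "'k::{real_normed_field, real_inner} ^ 'm ^ 'n"
  assumes u: "residual_minimiser Y c u" and v: "residual_minimiser Y c v"
  shows "Y *v u = Y *v v"
proof -
  define a b where "a = Y *v u" and "b = Y *v v"
  have eq: "norm a = norm b"
    using u v by (auto simp: residual_minimiser_def a_def b_def intro: antisym)
  have "norm a \<le> norm (Y *v (inverse 2 *s (u + v)))"
    using u v by (simp add: residual_minimiser_def a_def)
  also have "Y *v (inverse 2 *s (u + v)) = inverse 2 *s (a + b)"
    by (simp add: vector_scalar_commute matrix_vector_right_distrib a_def b_def)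
  also have "\<dots> = (1 / 2 :: real) *\<^sub>R (a + b)"
    by (simp add: vec_eq_iff) (simp add: scaleR_conv_of_real)
  finally have "2 * norm a \<le> norm (a + b)"
    by simp
  then have "(2 * norm a)\<^sup>2 \<le> (norm (a + b))\<^sup>2"
    by (intro power_mono) auto
  moreover have "(norm (a - b))\<^sup>2 = 2 * (norm a)\<^sup>2 + 2 * (norm b)\<^sup>2 - (norm (a + b))\<^sup>2"
    by (simp add: power2_norm_eq_inner inner_simps inner_commute)
  ultimately have "(norm (a - b))\<^sup>2 \<le> 0"
    using eq by (simp add: power_mult_distrib)
  then show ?thesis
    by (simp add: a_def b_def)
qed

text \<open>The only row that can be nonzero is \<open>axis c 1 - v\<close>. As \<open>v - u\<close>
  vanishes at \<open>c\<close>, it is orthogonal to \<open>axis c 1\<close> as well as to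
  \<open>u\<close>, and Pythagoras applies.\<close>

lemma norm_star_weights:
  fixes u v :: "'k::{real_normed_field, real_inner} ^ 'm"
  assumes "orthogonal u (v - u)" "(v - u) $ c = 0"
  shows "(norm (star_weights c v))\<^sup>2 = (norm (star_weights c u))\<^sup>2 + (norm (v - u))\<^sup>2"
proof -
  have norm: "(norm (star_weights c x))\<^sup>2 = (norm (axis c 1 - x))\<^sup>2" for x :: "'k ^ 'm"
    unfolding power2_norm_eq_inner inner_vec_def[of "star_weights c x"]
    by (subst sum.remove[of _ c]) (auto simp: star_weights_def)
  have "orthogonal (axis c 1 - u) (u - v)"
    using assms by (simp add: orthogonal_def inner_diff_left inner_diff_right inner_axis_axis inner_axis')
  then have "(norm ((axis c 1 - u) + (u - v)))\<^sup>2 = (norm (axis c 1 - u))\<^sup>2 + (norm (u - v))\<^sup>2"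
    by (rule norm_add_Pythagorean)
  then show ?thesis
    by (simp add: norm norm_minus_commute)
qed

section \<open>Comparison of the two estimates\<close>

text \<open>Each equivalence expresses existence and uniqueness together. Both estimates share
  \<open>\<Lambda>\<close>; the variances may differ away from the centre, where they come from the
  columns of \<open>f\<close> and \<open>g\<close>.\<close>

theorem stabilised_MLE_min_norm:
  fixes E :: "('m::finite \<times> 'm) set" and f g :: "'k::hermitian_field ^ 'm ^ 'n"
  assumes star: "star_shaped_DAG E" and ex: "\<exists>\<theta>. is_MLE E f \<theta>" and stab: "is_stabilisation f g"
  shows "\<exists>\<Lambda> \<omega> \<omega>'. (\<forall>\<theta>. is_MLE E g \<theta> \<longleftrightarrow> \<theta> = (\<Lambda>, \<omega>')) \<and>
                  (\<forall>\<theta>. is_min_norm_MLE E f \<theta> \<longleftrightarrow> \<theta> = (\<Lambda>, \<omega>))"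
proof -
  obtain c where pa: "\<And>i. pa E i = (if i = c then - {c} else {})"
    using star_shaped_DAG_pa[OF star] by blast
  note MLE = is_MLE_star_iff[OF pa]
  obtain f' where pert: "is_perturbation f f'" and g: "g = f + f'"
    using stab by (auto simp: is_stabilisation_def)
  obtain v where v: "residual_minimiser f c v" and col: "\<And>i. i \<noteq> c \<Longrightarrow> column i f \<noteq> 0"
    using ex unfolding MLE by blast
  \<comment> \<open>Removing the kernel component \<open>k\<close> keeps the residual, and keeps the
    entry \<open>1\<close> at \<open>c\<close> because \<open>k\<close> vanishes there.\<close>
  obtain k u where ku: "v = k + u" "k \<in> mat_ker f" "u \<in> herm_perp (mat_ker f)"
    by (rule mat_ker_decomposition)
  have fu: "f *v u = f *v v" and kc: "k $ c = 0"
    using ku residual_minimiser_kernel[OF v]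
    by (simp_all add: mat_ker_def matrix_vector_right_distrib)
  then have u: "residual_minimiser f c u"
    using v ku(1) by (simp add: residual_minimiser_def)
  have gu: "g *v u = f *v u"
    using perturbation_vanishes_on_perp_ker[OF pert ku(3)]
    by (simp add: g matrix_vector_mult_add_rdistrib)
  have norm_le: "norm (f *v x) \<le> norm (g *v x)" for x
  proof (rule power2_le_imp_le)
    show "(norm (f *v x))\<^sup>2 \<le> (norm (g *v x))\<^sup>2"
      unfolding g perturbation_orthogonal[OF pert] by simp
  qed simp
  have "norm (g *v u) \<le> norm (g *v x)" if "x $ c = 1" for x
  proof -
    have "norm (f *v u) \<le> norm (f *v x)"
      using u that by (simp add: residual_minimiser_def)
    with norm_le[of x] show ?thesis
      by (simp only: gu)
  qed
  then have ug: "residual_minimiser g c u"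
    using u by (simp add: residual_minimiser_def gu)
  have inj: "x = 0" if "g *v x = 0" for x
    using that unfolding g by (rule stabilisation_injective[OF pert])
  have uniq: "w = u" if "residual_minimiser g c w" for w
    using residual_minimiser_image_unique[OF that ug] inj[of "w - u"]
    by (simp add: matrix_vector_mult_diff_distrib)
  \<comment> \<open>Injectivity also rules out zero columns, at which the variance would
    degenerate.\<close>
  have "column i g \<noteq> 0" for i
    using inj[of "axis i 1"] by (auto simp: matrix_vector_mult_axis)
  then have g_MLE: "is_MLE E g \<theta> \<longleftrightarrow> \<theta> = (star_weights c u, star_variances g c u)" for \<theta>
    unfolding MLE using ug uniq by blast

  define \<theta>\<^sub>0 where "\<theta>\<^sub>0 = (star_weights c u, star_variances f c u)"
  have \<theta>\<^sub>0: "is_MLE E f \<theta>\<^sub>0"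
    unfolding MLE \<theta>\<^sub>0_def using u col by blast
  have less: "norm \<theta>\<^sub>0 < norm \<theta>" if \<theta>: "is_MLE E f \<theta>" "\<theta> \<noteq> \<theta>\<^sub>0" for \<theta>
  proof -
    obtain w where w: "residual_minimiser f c w"
      and \<theta>_eq: "\<theta> = (star_weights c w, star_variances f c w)"
      using \<theta>(1) unfolding MLE by blast
    have fw: "f *v w = f *v u"
      by (rule residual_minimiser_image_unique[OF w u])
    then have ker: "w - u \<in> mat_ker f"
      by (simp add: mat_ker_def matrix_vector_mult_diff_distrib)
    have "(w - u) $ c = 0"
      using w u by (simp add: residual_minimiser_def)
    then have "(norm (star_weights c w))\<^sup>2 = (norm (star_weights c u))\<^sup>2 + (norm (w - u))\<^sup>2"
      by (intro norm_star_weights orthogonal_herm_perp[OF ku(3) ker])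
    moreover have "w \<noteq> u"
      using \<theta>(2) by (auto simp: \<theta>_eq \<theta>\<^sub>0_def)
    \<comment> \<open>With equal variances, comparing the norms of the pairs reduces to comparing
      the weights.\<close>
    moreover have "star_variances f c w = star_variances f c u"
      by (simp add: star_variances_def fw cong: if_cong)
    ultimately show ?thesis
      by (simp add: \<theta>_eq \<theta>\<^sub>0_def norm_Pair)
  qed
  have "is_min_norm_MLE E f \<theta> \<longleftrightarrow> \<theta> = \<theta>\<^sub>0" for \<theta>
  proof
    assume "is_min_norm_MLE E f \<theta>"
    then show "\<theta> = \<theta>\<^sub>0"
      using less[of \<theta>] \<theta>\<^sub>0 unfolding is_min_norm_MLE_def is_arg_min_def by blast
  next
    assume "\<theta> = \<theta>\<^sub>0"
    moreover have "\<not> norm \<eta> < norm \<theta>\<^sub>0" if "is_MLE E f \<eta>" for \<eta>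
      using less[OF that] by (cases "\<eta> = \<theta>\<^sub>0") auto
    ultimately show "is_min_norm_MLE E f \<theta>"
      using \<theta>\<^sub>0 by (simp add: is_min_norm_MLE_def is_arg_min_def)
  qed
  with g_MLE show ?thesis
    unfolding \<theta>\<^sub>0_def by blast
qed

theorem theorem1p3:
  fixes E :: "('m::finite \<times> 'm) set"
    and fR :: "real ^ 'm ^ 'n"
    and fC :: "complex ^ 'm ^ 'n"
  assumes "CARD('m) \<le> CARD('n)"
    and "star_shaped_DAG E"
  shows "((\<exists>\<theta>. is_MLE E fR \<theta>) \<longrightarrow>
            (\<forall>g. is_stabilisation fR g \<longrightarrow>
              (\<exists>\<Lambda> \<omega> \<omega>'. (\<forall>\<theta>. is_MLE E g \<theta> \<longleftrightarrow> \<theta> = (\<Lambda>, \<omega>')) \<and>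
                         (\<forall>\<theta>. is_min_norm_MLE E fR \<theta> \<longleftrightarrow> \<theta> = (\<Lambda>, \<omega>))))) \<and>
         ((\<exists>\<theta>. is_MLE E fC \<theta>) \<longrightarrow>
            (\<forall>g. is_stabilisation fC g \<longrightarrow>
              (\<exists>\<Lambda> \<omega> \<omega>'. (\<forall>\<theta>. is_MLE E g \<theta> \<longleftrightarrow> \<theta> = (\<Lambda>, \<omega>')) \<and>
                         (\<forall>\<theta>. is_min_norm_MLE E fC \<theta> \<longleftrightarrow> \<theta> = (\<Lambda>, \<omega>)))))"
  by (intro conjI impI allI; rule stabilised_MLE_min_norm[OF assms(2)])

end
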